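(* Let $d$ be a positive integer and let $\rho$ be a density matrix on $M^{d^2}$ with ordered eigenvalues $\rho_1\ge\rho_2\ge\dots\ge\rho_{d^2}$ (counted with multiplicity). If $\rho_1>\frac{3}{d^2}$, then there exists a factorization $M^{d^2}=\mathcal{B}_1\otimes\mathcal{B}_2$ of type $(d,d)$ such that $\rho$ is entangled with respect to it.
   Context: $M^n$ denotes the algebra of complex $n\times n$ matrices; $M^{d^2}$ is identified with $M^{d}\otimes M^{d}$ acting on $\mathbb{C}^{d}\otimes\mathbb{C}^{d}$. A density matrix is $\rho\in M^{d^2}$ with $\rho=\rho^\dagger$, $\rho\ge 0$, $\operatorname{Tr}\rho=1$. A factorization of $M^{d^2}$ of type $(d,d)$ is a pair of subalgebras $\mathcal{B}_1=U(M^{d}\otimes \mathbb{1})U^\dagger$, $\mathcal{B}_2=U(\mathbb{1}\otimes M^{d})U^\dagger$ for some unitary $U\in M^{d^2}$; one writes $M^{d^2}=\mathcal{B}_1\otimes\mathcal{B}_2$. A state $\rho$ is separable with respect to $M^{d}\otimes M^{d}$ if $\rho=\sum_i \rho_{i1}\otimes\rho_{i2}$ (finite sum) with positive semidefinite $\rho_{i1},\rho_{i2}\in M^{d}$; otherwise it is entangled. It is separable (entangled) with respect to the factorization given by $U$ if $U^\dagger\rho U$ is separable (entangled) with respect to $M^{d}\otimes M^{d}$. *)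

theory Defs
  imports "Jordan_Normal_Form.Schur_Decomposition"
begin

definition mat_trace :: "complex mat \<Rightarrow> complex" where
  "mat_trace A = (\<Sum>i<dim_row A. A $$ (i, i))"

definition hermitian_mat :: "nat \<Rightarrow> complex mat \<Rightarrow> bool" where
  "hermitian_mat n A \<longleftrightarrow> A \<in> carrier_mat n n \<and> mat_adjoint A = A"

text \<open>The order on \<^typ>\<open>complex\<close> is the one in which \<open>0 \<le> z\<close> means that \<open>z\<close> is real and
  nonnegative.\<close>

definition positive_semidefinite :: "nat \<Rightarrow> complex mat \<Rightarrow> bool" where
  "positive_semidefinite n A \<longleftrightarrow>
     hermitian_mat n A \<and> (\<forall>v \<in> carrier_vec n. 0 \<le> (A *\<^sub>v v) \<bullet>c v)"

definition density_matrix :: "nat \<Rightarrow> complex mat \<Rightarrow> bool" where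
  "density_matrix n \<rho> \<longleftrightarrow> positive_semidefinite n \<rho> \<and> mat_trace \<rho> = 1"

definition unitary_mat :: "nat \<Rightarrow> complex mat \<Rightarrow> bool" where
  "unitary_mat n U \<longleftrightarrow> U \<in> carrier_mat n n \<and>
     U * mat_adjoint U = 1\<^sub>m n \<and> mat_adjoint U * U = 1\<^sub>m n"

text \<open>Kronecker product: the basis vector \<open>e\<^sub>i \<otimes> e\<^sub>j\<close> of \<open>\<complex>\<^sup>m \<otimes> \<complex>\<^sup>n\<close> has index \<open>i * n + j\<close>
  in \<open>\<complex>\<^sup>m\<^sup>n\<close>.\<close>

definition kron :: "complex mat \<Rightarrow> complex mat \<Rightarrow> complex mat" where
  "kron A B = mat (dim_row A * dim_row B) (dim_col A * dim_col B)
     (\<lambda>(i, j). A $$ (i div dim_row B, j div dim_col B) * B $$ (i mod dim_row B, j mod dim_col B))"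

text \<open>The real numbers in \<open>es\<close>, in nonincreasing order, are all the eigenvalues of \<open>A\<close>, each
  repeated according to its multiplicity as a root of the characteristic polynomial.\<close>

definition ordered_eigenvalues :: "complex mat \<Rightarrow> real list \<Rightarrow> bool" where
  "ordered_eigenvalues A es \<longleftrightarrow>
     char_poly A = (\<Prod>e\<leftarrow>es. [:- complex_of_real e, 1:]) \<and> sorted_wrt (\<ge>) es"

definition separable :: "nat \<Rightarrow> complex mat \<Rightarrow> bool" where
  "separable d \<rho> \<longleftrightarrow>
     (\<exists>ps. (\<forall>(A, B) \<in> set ps. positive_semidefinite d A \<and> positive_semidefinite d B) \<and>
           \<rho> = foldr (+) (map (\<lambda>(A, B). kron A B) ps) (0\<^sub>m (d\<^sup>2) (d\<^sup>2)))"

definition entangled :: "nat \<Rightarrow> complex mat \<Rightarrow> bool" where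
  "entangled d \<rho> \<longleftrightarrow> \<not> separable d \<rho>"

definition factorization_by :: "nat \<Rightarrow> complex mat \<Rightarrow> complex mat set \<Rightarrow> complex mat set \<Rightarrow> bool" where
  "factorization_by d U B1 B2 \<longleftrightarrow> unitary_mat (d\<^sup>2) U \<and>
     B1 = {U * kron A (1\<^sub>m d) * mat_adjoint U | A. A \<in> carrier_mat d d} \<and>
     B2 = {U * kron (1\<^sub>m d) A * mat_adjoint U | A. A \<in> carrier_mat d d}"

definition entangled_wrt :: "nat \<Rightarrow> complex mat \<Rightarrow> complex mat \<Rightarrow> bool" where
  "entangled_wrt d U \<rho> \<longleftrightarrow> entangled d (mat_adjoint U * \<rho> * U)"

end

theory Submission
  imports Defs
begin

text \<open>Complete a unit eigenvector \<open>v\<close> for \<open>m = \<rho>\<^sub>1\<close> to an orthonormal basis and let \<open>a, b, c\<close> be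
  the three further basis vectors with the smallest diagonal entries \<open>r x = \<langle>x, \<rho> x\<rangle>\<close>. Since the trace is \<open>1\<close>
  and \<open>m > 3 / d\<^sup>2\<close>, averaging gives \<open>r a + r b + r c < m\<close>. Choose \<open>U\<close> so that
  \<open>e\<^sub>0 \<otimes> e\<^sub>0\<close> and \<open>e\<^sub>1 \<otimes> e\<^sub>1\<close> are sent to \<open>(v \<plusminus> c) / \<surd>2\<close>, and \<open>e\<^sub>0 \<otimes> e\<^sub>1\<close> and \<open>e\<^sub>1 \<otimes> e\<^sub>0\<close> to \<open>a\<close> and \<open>b\<close>.
  A separable state has a positive partial transpose, whose value at the singlet vector is
  proportional to \<open>r a + r b - (m - r c)\<close>, a contradiction.\<close>

section \<open>Adjoints, traces and unitaries built from orthonormal bases\<close>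

lemma mat_adjoint_dim [simp]:
  "dim_row (mat_adjoint A) = dim_col A" "dim_col (mat_adjoint A) = dim_row A"
  by (auto simp: mat_adjoint_def mat_of_rows_def)

lemma mat_adjoint_carrier [simp]: "A \<in> carrier_mat n m \<Longrightarrow> mat_adjoint A \<in> carrier_mat m n"
  by auto

lemma mat_adjoint_index:
  assumes "A \<in> carrier_mat n m" "i < m" "j < n"
  shows "mat_adjoint A $$ (i, j) = conjugate (A $$ (j, i))"
  using assms by (auto simp: mat_adjoint_def mat_of_rows_def)

lemma mat_trace_mult_commute:
  assumes "A \<in> carrier_mat n n" "B \<in> carrier_mat n n"
  shows "mat_trace (A * B) = mat_trace (B * A)"
proof -
  have "mat_trace (A * B) = (\<Sum>i<n. \<Sum>j<n. A $$ (i, j) * B $$ (j, i))"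
    using assms by (simp add: mat_trace_def scalar_prod_def atLeast0LessThan)
  also have "\<dots> = (\<Sum>j<n. \<Sum>i<n. B $$ (j, i) * A $$ (i, j))"
    by (subst sum.swap) (simp add: mult.commute)
  also have "\<dots> = mat_trace (B * A)"
    using assms by (simp add: mat_trace_def scalar_prod_def atLeast0LessThan)
  finally show ?thesis .
qed

lemma mat_trace_unitary_conj:
  assumes U: "unitary_mat n U" and A: "A \<in> carrier_mat n n"
  shows "mat_trace (mat_adjoint U * A * U) = mat_trace A"
proof -
  have Uc: "U \<in> carrier_mat n n" and UU: "U * mat_adjoint U = 1\<^sub>m n"
    using U by (auto simp: unitary_mat_def)
  have Ua: "mat_adjoint U \<in> carrier_mat n n" using Uc by simp
  have "mat_trace (mat_adjoint U * A * U) = mat_trace (U * (mat_adjoint U * A))"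
    by (rule mat_trace_mult_commute[OF _ Uc]) (use Ua A in auto)
  also have "U * (mat_adjoint U * A) = A"
    unfolding assoc_mult_mat[OF Uc Ua A, symmetric] UU by (rule left_mult_one_mat[OF A])
  finally show ?thesis .
qed

lemma hermitian_mat_cscalar_prod:
  assumes A: "hermitian_mat n A" and x: "x \<in> carrier_vec n" and y: "y \<in> carrier_vec n"
  shows "(A *\<^sub>v x) \<bullet>c y = cnj ((A *\<^sub>v y) \<bullet>c x)"
proof -
  have Ac: "A \<in> carrier_mat n n" using A by (simp add: hermitian_mat_def)
  have h: "A $$ (i, j) = cnj (A $$ (j, i))" if "i < n" "j < n" for i j
    using mat_adjoint_index[OF Ac that] A by (simp add: hermitian_mat_def)
  have "(A *\<^sub>v x) \<bullet>c y = (\<Sum>i<n. \<Sum>j<n. A $$ (i, j) * x $ j * cnj (y $ i))"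
    using Ac x y by (simp add: scalar_prod_def atLeast0LessThan sum_distrib_right)
  also have "\<dots> = (\<Sum>j<n. \<Sum>i<n. A $$ (i, j) * x $ j * cnj (y $ i))"
    by (rule sum.swap)
  also have "\<dots> = (\<Sum>j<n. \<Sum>i<n. cnj (A $$ (j, i) * y $ i * cnj (x $ j)))"
    by (intro sum.cong refl) (subst h, auto)
  also have "\<dots> = cnj ((A *\<^sub>v y) \<bullet>c x)"
    using Ac x y by (simp add: scalar_prod_def atLeast0LessThan sum_distrib_right)
  finally show ?thesis .
qed

text \<open>This turns the choice of an orthonormal basis into a factorization: entries of the
  conjugated matrix are the matrix elements of \<open>A\<close> in the basis \<open>q\<close>. The
  column index goes to the first argument because \<open>\<bullet>c\<close> conjugates its second
  one.\<close>

lemma unitary_mat_of_orthonormal_cols: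
  assumes q: "\<And>i. i < n \<Longrightarrow> q i \<in> carrier_vec n"
    and orth: "\<And>i j. i < n \<Longrightarrow> j < n \<Longrightarrow> q i \<bullet>c q j = (if i = j then 1 else 0)"
    and U: "U = mat_of_cols n (map q [0..<n])"
  shows "unitary_mat n U"
    and "A \<in> carrier_mat n n \<Longrightarrow> i < n \<Longrightarrow> j < n \<Longrightarrow>
           (mat_adjoint U * A * U) $$ (i, j) = (A *\<^sub>v q j) \<bullet>c q i"
proof -
  have Uc: "U \<in> carrier_mat n n" unfolding U using mat_of_cols_carrier(1)[of n "map q [0..<n]"] by simp
  have Ua: "mat_adjoint U \<in> carrier_mat n n" using Uc by simp
  have colU: "col U j = q j" if "j < n" for j
    using that q unfolding U by (subst col_mat_of_cols) auto
  have rowU: "row (mat_adjoint U) i = conjugate (q i)" if i: "i < n" for i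
  proof (rule eq_vecI)
    show "dim_vec (row (mat_adjoint U) i) = dim_vec (conjugate (q i))"
      using Uc q[OF i] by simp
    fix k assume "k < dim_vec (conjugate (q i))"
    then have k: "k < n" using q[OF i] by simp
    have "U $$ (k, i) = q i $ k" using colU[OF i] Uc k i by (metis carrier_matD index_col)
    then show "row (mat_adjoint U) i $ k = conjugate (q i) $ k"
      using mat_adjoint_index[OF Uc i k] Uc i k q[OF i] by simp
  qed
  have ent: "(mat_adjoint U * (A * U)) $$ (i, j) = (A *\<^sub>v q j) \<bullet>c q i"
    if A: "A \<in> carrier_mat n n" and i: "i < n" and j: "j < n" for A i j
  proof -
    have "(mat_adjoint U * (A * U)) $$ (i, j) = row (mat_adjoint U) i \<bullet> col (A * U) j"
      by (rule index_mult_mat(1)) (use Ua Uc i j in auto)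
    also have "\<dots> = conjugate (q i) \<bullet> (A *\<^sub>v q j)"
      by (simp add: rowU[OF i] col_mult2[OF A Uc j] colU[OF j])
    also have "\<dots> = (A *\<^sub>v q j) \<bullet>c q i"
      by (rule comm_scalar_prod[of _ n]) (use q A i j in auto)
    finally show ?thesis .
  qed
  \<comment> \<open>This is the case \<open>A = 1\<close> of \<open>ent\<close>. For square matrices
    the other identity follows, as a left inverse is also a right inverse.\<close>
  have left: "mat_adjoint U * U = 1\<^sub>m n"
  proof (rule eq_matI)
    fix i j assume "i < dim_row (1\<^sub>m n :: complex mat)" "j < dim_col (1\<^sub>m n :: complex mat)"
    then have ij: "i < n" "j < n" by auto
    show "(mat_adjoint U * U) $$ (i, j) = 1\<^sub>m n $$ (i, j)"
      using ent[OF one_carrier_mat ij] orth[OF ij(2,1)] Uc q[OF ij(2)] ij by auto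
  qed (use Uc Ua in auto)
  then show "unitary_mat n U"
    using mat_mult_left_right_inverse[OF Ua Uc left] Uc by (simp add: unitary_mat_def)
  show "(mat_adjoint U * A * U) $$ (i, j) = (A *\<^sub>v q j) \<bullet>c q i"
    if "A \<in> carrier_mat n n" "i < n" "j < n"
    using ent[OF that] assoc_mult_mat[OF Ua that(1) Uc] by simp
qed

section \<open>Positive semidefinite minors and a necessary condition for separability\<close>

text \<open>Restricting the quadratic form to the span of two basis vectors leaves a positive
  semidefinite 2 by 2 block; the last claim says that its determinant is nonnegative.\<close>

lemma positive_semidefinite_minor:
  assumes A: "positive_semidefinite n A" and i: "i < n" and j: "j < n" and ij: "i \<noteq> j"
  shows "0 \<le> Re (A $$ (i, i))" "0 \<le> Re (A $$ (j, j))"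
    and "Im (A $$ (i, i)) = 0" "Im (A $$ (j, j)) = 0"
    and "(cmod (A $$ (i, j)))\<^sup>2 \<le> Re (A $$ (i, i)) * Re (A $$ (j, j))"
proof -
  have Ac: "A \<in> carrier_mat n n" and Ah: "mat_adjoint A = A"
    using A by (auto simp: positive_semidefinite_def hermitian_mat_def)
  have ji: "A $$ (j, i) = cnj (A $$ (i, j))"
    using mat_adjoint_index[OF Ac j i] Ah by simp
  have form: "0 \<le> (x * A $$ (i, i) + y * A $$ (i, j)) * cnj x
                 + (x * A $$ (j, i) + y * A $$ (j, j)) * cnj y" for x y
  proof -
    define v where "v = x \<cdot>\<^sub>v unit_vec n i + y \<cdot>\<^sub>v unit_vec n j"
    have v: "v \<in> carrier_vec n" by (simp add: v_def)
    have row: "(A *\<^sub>v v) $ k = x * A $$ (k, i) + y * A $$ (k, j)" if k: "k < n" for k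
    proof -
      have "(A *\<^sub>v v) $ k = row A k \<bullet> v" using Ac k by simp
      also have "\<dots> = x * (row A k \<bullet> unit_vec n i) + y * (row A k \<bullet> unit_vec n j)"
        unfolding v_def using Ac k
        by (subst scalar_prod_add_distrib[of _ n]) auto
      finally show ?thesis using Ac k i j by simp
    qed
    have "conjugate v = cnj x \<cdot>\<^sub>v unit_vec n i + cnj y \<cdot>\<^sub>v unit_vec n j"
      using i j by (intro eq_vecI) (auto simp: v_def)
    then have "(A *\<^sub>v v) \<bullet>c v
        = cnj x * ((A *\<^sub>v v) \<bullet> unit_vec n i) + cnj y * ((A *\<^sub>v v) \<bullet> unit_vec n j)"
      using Ac v by (simp add: scalar_prod_add_distrib[of _ n])
    also have "\<dots> = cnj x * (A *\<^sub>v v) $ i + cnj y * (A *\<^sub>v v) $ j"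
      using Ac v i j scalar_prod_right_unit[of _ n] by auto
    finally have "(A *\<^sub>v v) \<bullet>c v = \<dots>" .
    moreover have "0 \<le> (A *\<^sub>v v) \<bullet>c v"
      using A v by (simp add: positive_semidefinite_def)
    ultimately show ?thesis by (simp add: row i j mult.commute)
  qed
  define a where "a = Re (A $$ (i, i))"
  define c where "c = Re (A $$ (j, j))"
  define g where "g = A $$ (i, j)"
  show ai: "0 \<le> Re (A $$ (i, i))" "Im (A $$ (i, i)) = 0"
    using form[of 1 0] by (auto simp: less_eq_complex_def)
  show ci: "0 \<le> Re (A $$ (j, j))" "Im (A $$ (j, j)) = 0"
    using form[of 0 1] by (auto simp: less_eq_complex_def)
  have aeq: "A $$ (i, i) = of_real a" and ceq: "A $$ (j, j) = of_real c"
    using ai ci by (auto simp: a_def c_def complex_eq_iff)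
  have gg: "g * cnj g = of_real ((cmod g)\<^sup>2)" by (metis complex_norm_square of_real_power)
  \<comment> \<open>Taking \<open>x = r * g\<close> and \<open>y = -1\<close> cancels the phase of
    \<open>g\<close>, so the form becomes a real quadratic polynomial in \<open>r\<close>.\<close>
  have quad: "0 \<le> r\<^sup>2 * a * (cmod g)\<^sup>2 - 2 * r * (cmod g)\<^sup>2 + c" for r :: real
  proof -
    have "0 \<le> (of_real r * g * of_real a - g) * cnj (of_real r * g)
             + (of_real c - of_real r * g * cnj g)"
      using form[of "of_real r * g" "-1"] by (simp add: aeq ceq ji flip: g_def)
    also have "\<dots> = of_real (r\<^sup>2 * a) * (g * cnj g) - of_real (2 * r) * (g * cnj g) + of_real c"
      by (simp add: algebra_simps power2_eq_square)
    also have "\<dots> = of_real (r\<^sup>2 * a * (cmod g)\<^sup>2 - 2 * r * (cmod g)\<^sup>2 + c)"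
      by (simp add: gg)
    finally show ?thesis by (simp only: less_eq_complex_def Re_complex_of_real zero_complex.sel)
  qed
  have "(cmod g)\<^sup>2 \<le> a * c"
  proof (cases "a = 0")
    case True
    then have "r * (2 * (cmod g)\<^sup>2) \<le> c" for r using quad[of r] by simp
    \<comment> \<open>A linear function of \<open>r\<close> bounded by \<open>c\<close> has zero
      slope: for nonzero \<open>g\<close> this value of \<open>r\<close> would give
      \<open>c + 1 \<le> c\<close>.\<close>
    from this[of "(c + 1) / (2 * (cmod g)\<^sup>2)"] have "(cmod g)\<^sup>2 = 0"
      by (cases "g = 0") auto
    then show ?thesis using True by simp
  next
    case False
    then have a: "a > 0" using ai by (simp add: a_def)
    \<comment> \<open>The point \<open>r = 1 / a\<close> minimizes the quadratic when
      \<open>g\<close> is nonzero.\<close>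
    have "0 \<le> a * ((1 / a)\<^sup>2 * a * (cmod g)\<^sup>2 - 2 * (1 / a) * (cmod g)\<^sup>2 + c)"
      using quad[of "1 / a"] a by (intro mult_nonneg_nonneg) auto
    also have "\<dots> = a * c - (cmod g)\<^sup>2"
      using a by (simp add: field_simps power2_eq_square)
    finally show ?thesis by simp
  qed
  then show "(cmod (A $$ (i, j)))\<^sup>2 \<le> Re (A $$ (i, i)) * Re (A $$ (j, j))"
    by (simp add: a_def c_def g_def)
qed

lemma kron_carrier:
  "A \<in> carrier_mat d d \<Longrightarrow> B \<in> carrier_mat d d \<Longrightarrow> kron A B \<in> carrier_mat (d\<^sup>2) (d\<^sup>2)"
  by (auto simp: kron_def power2_eq_square)

lemma index_bounds:
  assumes "2 \<le> (d :: nat)"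
  shows "1 < d\<^sup>2" "d + 1 < d\<^sup>2"
proof -
  have "d * 2 \<le> d\<^sup>2" using assms by (simp add: power2_eq_square)
  then show "1 < d\<^sup>2" "d + 1 < d\<^sup>2" using assms by linarith+
qed

text \<open>The indices 0, 1, \<open>d\<close>, \<open>d + 1\<close> stand for the basis vectors 00,
  01, 10, 11 of the tensor product. Multiplying the minor inequalities of \<open>A\<close> and
  \<open>B\<close> bounds the squared modulus of the entry at \<open>(0, d + 1)\<close> by the
  product of the two diagonal entries; the inequality of arithmetic and geometric means then gives
  the claim.\<close>

lemma kron_witness:
  assumes d: "2 \<le> d" and A: "positive_semidefinite d A" and B: "positive_semidefinite d B"
  shows "2 * Re (kron A B $$ (0, d + 1)) \<le> Re (kron A B $$ (1, 1)) + Re (kron A B $$ (d, d))"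
proof -
  have Ac: "A \<in> carrier_mat d d" and Bc: "B \<in> carrier_mat d d"
    using A B by (auto simp: positive_semidefinite_def hermitian_mat_def)
  have ix: "1 < d * d" "d + 1 < d * d" using index_bounds[OF d] by (auto simp: power2_eq_square)
  have md: "Suc d div d = 1" "Suc d mod d = 1"
    using d by (auto simp: Suc_times_mod_eq div_add1_eq[of d 1, simplified] mod_Suc)
  have k01: "kron A B $$ (0, d + 1) = A $$ (0, 1) * B $$ (0, 1)"
    using Ac Bc ix d md by (simp add: kron_def)
  have k11: "kron A B $$ (1, 1) = A $$ (0, 0) * B $$ (1, 1)"
    using Ac Bc ix d by (simp add: kron_def)
  have kdd: "kron A B $$ (d, d) = A $$ (1, 1) * B $$ (0, 0)"
    using Ac Bc ix d by (simp add: kron_def)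
  have dd: "0 < d" "1 < d" "(0::nat) \<noteq> 1" using d by auto
  note mA = positive_semidefinite_minor[OF A dd] and mB = positive_semidefinite_minor[OF B dd]
  define x where "x = Re (A $$ (0, 0)) * Re (B $$ (1, 1))"
  define y where "y = Re (A $$ (1, 1)) * Re (B $$ (0, 0))"
  define z where "z = cmod (A $$ (0, 1)) * cmod (B $$ (0, 1))"
  have "z\<^sup>2 \<le> (Re (A $$ (0, 0)) * Re (A $$ (1, 1))) * (Re (B $$ (0, 0)) * Re (B $$ (1, 1)))"
    unfolding z_def power_mult_distrib using mA mB by (intro mult_mono) auto
  then have "z\<^sup>2 \<le> x * y" by (simp add: x_def y_def mult_ac)
  moreover have "4 * (x * y) \<le> (x + y)\<^sup>2"
    using zero_le_power2[of "x - y"] by (simp add: power2_eq_square algebra_simps)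
  ultimately have "(2 * z)\<^sup>2 \<le> (x + y)\<^sup>2" by (simp add: power_mult_distrib)
  moreover have "0 \<le> x + y" using mA mB by (simp add: x_def y_def)
  ultimately have "2 * z \<le> x + y" by (rule power2_le_imp_le)
  moreover have "Re (A $$ (0, 1) * B $$ (0, 1)) \<le> z"
    unfolding z_def norm_mult[symmetric] by (rule complex_Re_le_cmod)
  ultimately show ?thesis unfolding k01 k11 kdd using mA mB by (simp add: x_def y_def)
qed

text \<open>The entanglement witness is the partial transpose of the projection onto
  \<open>e\<^sub>0 \<otimes> e\<^sub>1 - e\<^sub>1 \<otimes> e\<^sub>0\<close>.\<close>

lemma separable_witness:
  assumes d: "2 \<le> d" and M: "separable d M"
  shows "2 * Re (M $$ (0, d + 1)) \<le> Re (M $$ (1, 1)) + Re (M $$ (d, d))"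
proof -
  obtain ps where ps: "\<forall>(A, B) \<in> set ps. positive_semidefinite d A \<and> positive_semidefinite d B"
    and Meq: "M = foldr (+) (map (\<lambda>(A, B). kron A B) ps) (0\<^sub>m (d\<^sup>2) (d\<^sup>2))"
    using M by (auto simp: separable_def)
  have ix: "1 < d\<^sup>2" "d + 1 < d\<^sup>2" using index_bounds[OF d] .
  let ?S = "\<lambda>ps. foldr (+) (map (\<lambda>(A, B). kron A B) ps) (0\<^sub>m (d\<^sup>2) (d\<^sup>2))"
  \<comment> \<open>The dimensions are carried through the induction because entries of a matrix sum
    can be split only within its bounds.\<close>
  have "?S ps \<in> carrier_mat (d\<^sup>2) (d\<^sup>2) \<and>
      2 * Re (?S ps $$ (0, d + 1)) \<le> Re (?S ps $$ (1, 1)) + Re (?S ps $$ (d, d))"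
    using ps
  proof (induction ps)
    case Nil
    have "0 < d\<^sup>2" using ix by linarith
    then show ?case using ix d by simp
  next
    case (Cons p ps)
    obtain A B where p: "p = (A, B)" by force
    have AB: "positive_semidefinite d A" "positive_semidefinite d B"
      using Cons.prems by (auto simp: p)
    then have K: "kron A B \<in> carrier_mat (d\<^sup>2) (d\<^sup>2)"
      by (auto intro!: kron_carrier simp: positive_semidefinite_def hermitian_mat_def)
    have S: "?S ps \<in> carrier_mat (d\<^sup>2) (d\<^sup>2)"
      and IH: "2 * Re (?S ps $$ (0, d + 1)) \<le> Re (?S ps $$ (1, 1)) + Re (?S ps $$ (d, d))"
      using Cons by auto
    have "0 < d\<^sup>2" "d < d\<^sup>2" using ix by linarith+
    then show ?case using K S IH kron_witness[OF d AB] ix by (simp add: p)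
  qed
  then show ?thesis by (simp add: Meq)
qed

section \<open>Orthonormal bases: completion, choice of small diagonal entries, rotation and
  trace\<close>

text \<open>Gram-Schmidt keeps its first vector, so normalizing the output changes \<open>v\<close>
  only by a scalar. If \<open>v\<close> is an eigenvector, so is the first basis vector.\<close>

lemma orthonormal_basis_completion:
  fixes v :: "complex vec"
  assumes v: "v \<in> carrier_vec n" and v0: "v \<noteq> 0\<^sub>v n"
  obtains \<alpha> us where "set (\<alpha> \<cdot>\<^sub>v v # us) \<subseteq> carrier_vec n" "distinct (\<alpha> \<cdot>\<^sub>v v # us)"
    "Suc (length us) = n"
    "\<And>x y. x \<in> set (\<alpha> \<cdot>\<^sub>v v # us) \<Longrightarrow> y \<in> set (\<alpha> \<cdot>\<^sub>v v # us) \<Longrightarrow>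
       x \<bullet>c y = (if x = y then 1 else 0)"
proof -
  interpret cof_vec_space n "TYPE(complex)" .
  define b where "b = basis_completion v"
  define ws where "ws = gram_schmidt n b"
  note bc = basis_completion[OF v v0, folded b_def]
  have n: "n \<noteq> 0" using v v0 by auto
  obtain vs where bv: "b = v # vs" using bc(6,7) n by (cases b) auto
  from gram_schmidt_result[OF bc(2,4,5) refl, folded ws_def]
  have ws: "set ws \<subseteq> carrier_vec n" "corthogonal ws" "length ws = n" using bc by auto
  have hd: "hd ws = v" using gram_schmidt_hd[OF v, of vs] by (simp add: ws_def bv)
  then obtain zs where zs: "ws = v # zs" using ws(3) n by (cases ws) auto
  define \<alpha> where "\<alpha> w = complex_of_real (1 / sqrt (Re (w \<bullet>c w)))" for w :: "complex vec"
  define f where "f w = \<alpha> w \<cdot>\<^sub>v w" for w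
  have inner: "f (ws ! i) \<bullet>c f (ws ! j) = (if i = j then 1 else 0)"
    if ij: "i < n" "j < n" for i j
  proof -
    have c: "ws ! i \<in> carrier_vec n" "ws ! j \<in> carrier_vec n" using ws ij by auto
    have o: "(ws ! i \<bullet>c ws ! j = 0) = (i \<noteq> j)"
      using corthogonalD[OF ws(2)] ij ws(3) by auto
    have e: "f (ws ! i) \<bullet>c f (ws ! j) = \<alpha> (ws ! i) * \<alpha> (ws ! j) * (ws ! i \<bullet>c ws ! j)"
      using c by (simp add: f_def conjugate_smult_vec \<alpha>_def)
    show ?thesis
    proof (cases "i = j")
      case False
      then show ?thesis using o e by simp
    next
      case True
      define t where "t = Re (ws ! i \<bullet>c ws ! i)"
      have "0 \<le> ws ! i \<bullet>c ws ! i" by (rule conjugate_square_ge_0_vec)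
      then have t: "ws ! i \<bullet>c ws ! i = of_real t" "0 \<le> t"
        by (auto simp: t_def less_eq_complex_def complex_eq_iff)
      \<comment> \<open>\<open>corthogonal\<close> is an equivalence: it also excludes zero products
        of a vector with itself.\<close>
      then have "t > 0" using o True by (cases "t = 0") auto
      have "f (ws ! i) \<bullet>c f (ws ! j) = of_real (1 / sqrt t * (1 / sqrt t) * t)"
        using e unfolding \<alpha>_def True[symmetric] t Re_complex_of_real by (simp only: of_real_mult)
      also have "1 / sqrt t * (1 / sqrt t) * t = 1" using \<open>t > 0\<close> by simp
      finally show ?thesis using True by simp
    qed
  qed
  let ?q = "map f ws"
  have len: "length ?q = n" using ws by simp
  have q: "?q = \<alpha> v \<cdot>\<^sub>v v # map f zs" by (simp add: zs f_def)
  \<comment> \<open>Two equal vectors at different positions would have inner product both 0 and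
    1.\<close>
  have dist: "distinct ?q"
    unfolding distinct_conv_nth len using inner ws(3)
    by (metis len nth_map zero_neq_one)
  have orth: "x \<bullet>c y = (if x = y then 1 else 0)" if xy: "x \<in> set ?q" "y \<in> set ?q" for x y
  proof -
    obtain i j where "i < n" "j < n" "x = f (ws ! i)" "y = f (ws ! j)"
      using xy ws(3) by (metis in_set_conv_nth len nth_map)
    then show ?thesis using inner nth_eq_iff_index_eq[OF dist, of i j] ws(3) by simp
  qed
  have "set ?q \<subseteq> carrier_vec n" using ws(1) by (auto simp: f_def)
  moreover have "Suc (length (map f zs)) = n" using ws(3) zs by simp
  ultimately show ?thesis using that[of "\<alpha> v" "map f zs"] dist orth unfolding q by blast
qed

text \<open>After sorting by \<open>r\<close>, the value \<open>r c\<close> is at least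
  \<open>r a\<close> and \<open>r b\<close> and at most every value on \<open>xs\<close>, so the
  mean over the three is at most the mean over the whole list. The multiset equation lets
  distinctness and length pass to the rearranged basis.\<close>

lemma three_least_le_average:
  fixes r :: "'a \<Rightarrow> real"
  assumes "3 \<le> length us"
  obtains a b c xs where "mset us = mset (a # b # c # xs)"
    "real (length us) * (r a + r b + r c) \<le> 3 * sum_list (map r us)"
proof -
  define s where "s = sort_key r us"
  have ms: "mset s = mset us" by (simp add: s_def)
  have so: "sorted (map r s)" by (simp add: s_def)
  have len: "length s = length us" by (simp add: s_def)
  obtain a b c xs where s: "s = a # b # c # xs"
    using assms len by (cases s; cases "tl s"; cases "tl (tl s)") auto
  have sums: "sum_list (map r us) = sum_list (map r s)"
    using ms by (metis mset_map sum_mset_sum_list)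
  have "real (length xs) * r c \<le> sum_list (map r xs)"
    using sum_list_mono[of xs "\<lambda>_. r c" r] so by (simp add: s sum_list_triv)
  moreover have "real (length xs) * (r a + r b + r c) \<le> real (length xs) * (3 * r c)"
    using so by (intro mult_left_mono) (auto simp: s)
  ultimately have "real (length us) * (r a + r b + r c) \<le> 3 * sum_list (map r us)"
    by (simp add: sums s flip: len) (simp add: algebra_simps)
  then show ?thesis using that[of a b c xs] ms s by simp
qed

lemma cscalar_prod_lincomb:
  fixes a b w :: "complex vec"
  assumes "a \<in> carrier_vec n" "b \<in> carrier_vec n" "w \<in> carrier_vec n"
  shows "(s \<cdot>\<^sub>v a + t \<cdot>\<^sub>v b) \<bullet>c w = s * (a \<bullet>c w) + t * (b \<bullet>c w)"
    and "w \<bullet>c (s \<cdot>\<^sub>v a + t \<cdot>\<^sub>v b) = cnj s * (w \<bullet>c a) + cnj t * (w \<bullet>c b)"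
  using assms
  by (simp_all add: add_scalar_prod_distrib[of _ n] conjugate_add_vec[of _ n]
      scalar_prod_add_distrib[of _ n] conjugate_smult_vec)

text \<open>Within the plane of \<open>q 0\<close> and \<open>q k\<close>, the normalized sum and
  difference again form an orthonormal pair, and the plane stays orthogonal to the remaining
  vectors.\<close>

lemma orthonormal_rotate:
  fixes q :: "nat \<Rightarrow> complex vec"
  assumes q: "\<And>i. i < n \<Longrightarrow> q i \<in> carrier_vec n"
    and orth: "\<And>i j. i < n \<Longrightarrow> j < n \<Longrightarrow> q i \<bullet>c q j = (if i = j then 1 else 0)"
    and k: "0 < k" "k < n"
    and s: "cnj s = s" "s * s = 1 / 2"
    and q': "q' = q(0 := s \<cdot>\<^sub>v q 0 + s \<cdot>\<^sub>v q k, k := s \<cdot>\<^sub>v q 0 + (- s) \<cdot>\<^sub>v q k)"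
    and ij: "i < n" "j < n"
  shows "q' i \<in> carrier_vec n" "q' i \<bullet>c q' j = (if i = j then 1 else 0)"
proof -
  have n: "0 < n" using k by simp
  have s2: "2 * (s * s) = 1" unfolding s(2) by simp
  have c: "q 0 \<in> carrier_vec n" "q k \<in> carrier_vec n" using q n k by auto
  have c': "q' l \<in> carrier_vec n" if "l < n" for l using q[OF that] c by (auto simp: q')
  then show "q' i \<in> carrier_vec n" using ij by simp
  have l: "q' l \<bullet>c w = (if l = 0 then s * (q 0 \<bullet>c w) + s * (q k \<bullet>c w)
             else if l = k then s * (q 0 \<bullet>c w) - s * (q k \<bullet>c w) else q l \<bullet>c w)"
    if "w \<in> carrier_vec n" for l w
    using cscalar_prod_lincomb(1)[OF c that] k by (simp add: q')
  have r: "w \<bullet>c q' l = (if l = 0 then s * (w \<bullet>c q 0) + s * (w \<bullet>c q k)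
             else if l = k then s * (w \<bullet>c q 0) - s * (w \<bullet>c q k) else w \<bullet>c q l)"
    if "w \<in> carrier_vec n" for l w
    using cscalar_prod_lincomb(2)[OF c that] k s(1) by (simp add: q')
  show "q' i \<bullet>c q' j = (if i = j then 1 else 0)"
    unfolding l[OF c'[OF ij(2)]] using k n ij s2
    by (auto simp add: r[OF q] orth)
qed

lemma distinct_orthonormal_nth:
  fixes qs :: "complex vec list"
  assumes "distinct qs" "i < length qs" "j < length qs"
    and "\<And>x y. x \<in> set qs \<Longrightarrow> y \<in> set qs \<Longrightarrow> x \<bullet>c y = (if x = y then 1 else 0)"
  shows "qs ! i \<bullet>c qs ! j = (if i = j then 1 else 0)"
  using assms by (simp add: nth_eq_iff_index_eq)

lemma Re_sum_list: "(\<Sum>x\<leftarrow>xs. Re (f x)) = Re (\<Sum>x\<leftarrow>xs. f x)"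
  by (induction xs) auto

text \<open>The basis gives a unitary, and conjugation by it preserves the trace. This makes the
  trace condition usable in a basis that need not diagonalize \<open>A\<close>.\<close>

lemma trace_orthonormal_basis:
  fixes qs :: "complex vec list"
  assumes c: "set qs \<subseteq> carrier_vec n" and d: "distinct qs" and len: "length qs = n"
    and orth: "\<And>x y. x \<in> set qs \<Longrightarrow> y \<in> set qs \<Longrightarrow> x \<bullet>c y = (if x = y then 1 else 0)"
    and A: "A \<in> carrier_mat n n"
  shows "(\<Sum>x\<leftarrow>qs. (A *\<^sub>v x) \<bullet>c x) = mat_trace A"
proof -
  define U where "U = mat_of_cols n (map ((!) qs) [0..<n])"
  have q: "qs ! i \<in> carrier_vec n" if "i < n" for i using c that len by (auto simp: subset_iff)
  have o: "qs ! i \<bullet>c qs ! j = (if i = j then 1 else 0)" if "i < n" "j < n" for i j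
    by (rule distinct_orthonormal_nth[OF d]) (use that len orth in auto)
  note U = unitary_mat_of_orthonormal_cols[of n "(!) qs", OF q o U_def]
  have "(\<Sum>x\<leftarrow>qs. (A *\<^sub>v x) \<bullet>c x) = (\<Sum>i<n. (A *\<^sub>v (qs ! i)) \<bullet>c (qs ! i))"
    by (simp add: sum_list_sum_nth len atLeast0LessThan)
  also have "\<dots> = (\<Sum>i<n. (mat_adjoint U * A * U) $$ (i, i))"
    using U(2)[OF _ _ _ A] by simp
  also have "\<dots> = mat_trace (mat_adjoint U * A * U)"
    using U(1) by (auto simp: mat_trace_def unitary_mat_def)
  also have "\<dots> = mat_trace A"
    by (rule mat_trace_unitary_conj[OF _ A]) (use U(1) in auto)
  finally show ?thesis .
qed

section \<open>The entangling unitary and the eigenvalue bound\<close>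

text \<open>Besides the eigenvector, the only data of \<open>\<rho>\<close> that enter are three of its diagonal
  entries, so no full diagonalization is needed.\<close>

lemma entangled_wrt_of_orthonormal_basis:
  fixes v a b c :: "complex vec" and r :: "complex vec \<Rightarrow> real"
  assumes d: "2 \<le> d" and \<rho>: "hermitian_mat (d\<^sup>2) \<rho>"
    and qs: "set (v # a # b # c # xs) \<subseteq> carrier_vec (d\<^sup>2)" "distinct (v # a # b # c # xs)"
      "length (v # a # b # c # xs) = d\<^sup>2"
    and orth: "\<And>x y. x \<in> set (v # a # b # c # xs) \<Longrightarrow> y \<in> set (v # a # b # c # xs) \<Longrightarrow>
       x \<bullet>c y = (if x = y then 1 else 0)"
    and ev: "\<rho> *\<^sub>v v = complex_of_real m \<cdot>\<^sub>v v"
    and r: "r = (\<lambda>x. Re ((\<rho> *\<^sub>v x) \<bullet>c x))"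
    and less: "r a + r b + r c < m"
  shows "\<exists>U. unitary_mat (d\<^sup>2) U \<and> entangled_wrt d U \<rho>"
proof -
  define n where "n = d\<^sup>2"
  \<comment> \<open>The two leading vectors and \<open>d - 2\<close> fillers put \<open>b\<close>
    and \<open>c\<close> at positions \<open>d\<close> and \<open>d + 1\<close>, the indices of 10
    and 11.\<close>
  define ys where "ys = v # a # take (d - 2) xs @ [b, c] @ drop (d - 2) xs"
  define q where "q = (!) ys"
  define s where "s = complex_of_real (1 / sqrt 2)"
  define q' where "q' = q(0 := s \<cdot>\<^sub>v q 0 + s \<cdot>\<^sub>v q (d + 1),
                          d + 1 := s \<cdot>\<^sub>v q 0 + (- s) \<cdot>\<^sub>v q (d + 1))"
  define U where "U = mat_of_cols n (map q' [0..<n])"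
  have \<rho>c: "\<rho> \<in> carrier_mat n n" using \<rho> by (simp add: hermitian_mat_def n_def)
  have s: "cnj s = s" "s * s = 1 / 2"
    by (simp_all add: s_def flip: of_real_mult)
  have ix: "0 < n" "1 < n" "d < n" "d + 1 < n"
    using index_bounds[OF d] d by (auto simp: n_def)
  have "mset xs = mset (take (d - 2) xs @ drop (d - 2) xs)" by simp
  then have "mset ys = mset (v # a # b # c # xs)" unfolding ys_def mset_append by simp
  then have ys: "set ys = set (v # a # b # c # xs)" "distinct ys" "length ys = n"
    using qs(2,3) unfolding n_def by (metis mset_eq_setD, metis mset_eq_imp_distinct_iff,
      metis size_mset)
  \<comment> \<open>This ensures that \<open>xs\<close>, of length \<open>d\<^sup>2 - 4\<close>,
    contains the \<open>d - 2\<close> fillers.\<close>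
  have "2 * d \<le> d\<^sup>2" using d by (simp add: power2_eq_square)
  then have lt: "length (take (d - 2) xs) = d - 2" using qs(3) d by auto
  have "ys ! d = (take (d - 2) xs @ [b, c] @ drop (d - 2) xs) ! (d - 2)"
    "ys ! (d + 1) = (take (d - 2) xs @ [b, c] @ drop (d - 2) xs) ! (d - 1)"
    using d by (auto simp: ys_def nth_Cons' numeral_2_eq_2)
  then have qv: "q 0 = v" "q 1 = a" "q d = b" "q (d + 1) = c"
    using lt d by (auto simp: q_def ys_def nth_append)
  have carr: "v \<in> carrier_vec n" "c \<in> carrier_vec n" using qs(1) by (auto simp: n_def)
  have qc: "q i \<in> carrier_vec n" if "i < n" for i
    using qs(1) that unfolding q_def n_def ys(1)[symmetric] by (metis n_def nth_mem subsetD ys(3))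
  have qo: "q i \<bullet>c q j = (if i = j then 1 else 0)" if "i < n" "j < n" for i j
    unfolding q_def
    by (rule distinct_orthonormal_nth[OF ys(2) _ _ orth[folded ys(1)]]) (use that ys(3) in auto)
  have dp: "0 < d + 1" by simp
  have q'_orth: "q' i \<in> carrier_vec n" "q' i \<bullet>c q' j = (if i = j then 1 else 0)"
    if "i < n" "j < n" for i j
    using orthonormal_rotate[OF qc qo dp ix(4) s q'_def that] by auto
  note U = unitary_mat_of_orthonormal_cols[of n q', OF q'_orth(1)[OF _ ix(1)] q'_orth(2) U_def]
  define M where "M = mat_adjoint U * \<rho> * U"
  have M: "M $$ (i, j) = (\<rho> *\<^sub>v q' j) \<bullet>c q' i" if "i < n" "j < n" for i j
    unfolding M_def using U(2)[OF _ _ _ \<rho>c that] by simp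
  have "M $$ (1, 1) = (\<rho> *\<^sub>v a) \<bullet>c a" "M $$ (d, d) = (\<rho> *\<^sub>v b) \<bullet>c b"
    using M ix d qv by (auto simp: q'_def)
  then have diag: "Re (M $$ (1, 1)) = r a" "Re (M $$ (d, d)) = r b" by (auto simp: r)
  have vv: "v \<bullet>c v = 1" "c \<bullet>c c = 1" "v \<bullet>c c = 0" "c \<bullet>c v = 0"
    using qo[of 0 0] qo[of "d + 1" "d + 1"] qo[of 0 "d + 1"] qo[of "d + 1" 0] ix qv by auto
  have \<rho>v: "(\<rho> *\<^sub>v v) \<bullet>c v = of_real m" "(\<rho> *\<^sub>v v) \<bullet>c c = 0"
    using carr by (simp_all add: ev vv)
  then have \<rho>cv: "(\<rho> *\<^sub>v c) \<bullet>c v = 0"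
    using hermitian_mat_cscalar_prod[OF \<rho>, folded n_def, OF carr(2,1)] by simp
  have \<rho>vc: "\<rho> *\<^sub>v v \<in> carrier_vec n" "\<rho> *\<^sub>v c \<in> carrier_vec n" using \<rho>c carr by auto
  \<comment> \<open>The cross terms vanish because \<open>v\<close> is an eigenvector orthogonal to
    \<open>c\<close>. The opposite signs of \<open>c\<close> leave half the difference of the
    diagonal values at \<open>v\<close> and \<open>c\<close>.\<close>
  have "M $$ (0, d + 1) = (\<rho> *\<^sub>v (s \<cdot>\<^sub>v v + (- s) \<cdot>\<^sub>v c)) \<bullet>c (s \<cdot>\<^sub>v v + s \<cdot>\<^sub>v c)"
    using M[OF ix(1,4)] qv by (simp add: q'_def)
  also have "\<rho> *\<^sub>v (s \<cdot>\<^sub>v v + (- s) \<cdot>\<^sub>v c) = s \<cdot>\<^sub>v (\<rho> *\<^sub>v v) + (- s) \<cdot>\<^sub>v (\<rho> *\<^sub>v c)"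
    using \<rho>c carr by (simp add: mult_add_distrib_mat_vec[of _ n n] mult_mat_vec[of _ n n])
  also have "\<dots> \<bullet>c (s \<cdot>\<^sub>v v + s \<cdot>\<^sub>v c) = (s * s) * (of_real m - (\<rho> *\<^sub>v c) \<bullet>c c)"
    using carr \<rho>vc
    by (simp add: cscalar_prod_lincomb[of _ n] \<rho>v \<rho>cv s(1) algebra_simps del: conjugate_complex_def)
  finally have "Re (M $$ (0, d + 1)) = Re (1 / 2 * (of_real m - (\<rho> *\<^sub>v c) \<bullet>c c))"
    unfolding s(2) by (rule arg_cong)
  also have "\<dots> = (m - r c) / 2" by (simp add: r)
  finally have "2 * Re (M $$ (0, d + 1)) = m - r c" by simp
  then have "\<not> separable d M" using separable_witness[OF d, of M] diag less by auto
  then show ?thesis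
    using U(1) unfolding entangled_wrt_def entangled_def M_def n_def by blast
qed

theorem theorem3:
  fixes d :: nat and \<rho> :: "complex mat" and es :: "real list"
  assumes "d > 0"
    and "density_matrix (d\<^sup>2) \<rho>"
    and "ordered_eigenvalues \<rho> es"
    and "es ! 0 > 3 / (real d)\<^sup>2"
  shows "\<exists>U B1 B2. factorization_by d U B1 B2 \<and> entangled_wrt d U \<rho>"
proof -
  define n where "n = d\<^sup>2"
  define m where "m = es ! 0"
  define r where "r = (\<lambda>x. Re ((\<rho> *\<^sub>v x) \<bullet>c x))"
  have n: "0 < n" using assms(1) by (simp add: n_def)
  have herm: "hermitian_mat (d\<^sup>2) \<rho>" and tr: "mat_trace \<rho> = 1"
    using assms(2) by (auto simp: density_matrix_def positive_semidefinite_def)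
  have \<rho>c: "\<rho> \<in> carrier_mat n n" using herm by (simp add: hermitian_mat_def n_def)
  have cp: "char_poly \<rho> = (\<Prod>e\<leftarrow>es. [:- complex_of_real e, 1:])"
    using assms(3) by (simp add: ordered_eigenvalues_def)
  \<comment> \<open>An empty list would make the characteristic polynomial constant and
    \<open>es ! 0\<close> unspecified.\<close>
  have "es \<noteq> []" using cp degree_monic_char_poly[OF \<rho>c] n by auto
  then have "poly (char_poly \<rho>) (of_real m) = 0" unfolding cp m_def by (cases es) auto
  then obtain w where "eigenvector \<rho> w (of_real m)"
    using eigenvalue_root_char_poly[OF \<rho>c] unfolding eigenvalue_def by blast
  then have w: "w \<in> carrier_vec n" "w \<noteq> 0\<^sub>v n" "\<rho> *\<^sub>v w = of_real m \<cdot>\<^sub>v w"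
    using \<rho>c by (auto simp: eigenvector_def)
  obtain \<alpha> us where us: "set (\<alpha> \<cdot>\<^sub>v w # us) \<subseteq> carrier_vec n" "distinct (\<alpha> \<cdot>\<^sub>v w # us)"
      "Suc (length us) = n"
    and orth: "\<And>x y. x \<in> set (\<alpha> \<cdot>\<^sub>v w # us) \<Longrightarrow> y \<in> set (\<alpha> \<cdot>\<^sub>v w # us) \<Longrightarrow>
       x \<bullet>c y = (if x = y then 1 else 0)"
    using orthonormal_basis_completion[OF w(1,2)] by metis
  define v where "v = \<alpha> \<cdot>\<^sub>v w"
  note us = us[folded v_def] and orth = orth[folded v_def]
  have ev: "\<rho> *\<^sub>v v = of_real m \<cdot>\<^sub>v v"
    using w \<rho>c by (simp add: v_def mult_mat_vec[of _ n n] smult_smult_assoc mult.commute)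
  have "r v = m" using orth[of v v] us(1) by (simp add: r_def ev)
  then have "m + (\<Sum>x\<leftarrow>us. r x) = (\<Sum>x\<leftarrow>v # us. r x)" by simp
  also have "\<dots> = Re (\<Sum>x\<leftarrow>v # us. (\<rho> *\<^sub>v x) \<bullet>c x)"
    unfolding r_def by (rule Re_sum_list)
  also have "(\<Sum>x\<leftarrow>v # us. (\<rho> *\<^sub>v x) \<bullet>c x) = mat_trace \<rho>"
    by (rule trace_orthonormal_basis[OF us(1,2) _ orth \<rho>c]) (use us(3) in simp_all)
  finally have sum: "m + (\<Sum>x\<leftarrow>us. r x) = 1" by (simp add: tr)
  have "3 / real n < m" using assms(4) by (simp add: n_def m_def)
  then have m: "3 < real n * m" using n by (simp add: field_simps)
  \<comment> \<open>For \<open>d = 1\<close> the list \<open>us\<close> is empty, so the trace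
    forces \<open>m = 1\<close>, whereas the hypothesis requires \<open>m > 3\<close>.\<close>
  have d: "2 \<le> d"
  proof (rule ccontr)
    assume "\<not> 2 \<le> d"
    then have "n = 1" using assms(1) by (simp add: n_def not_le less_2_cases_iff)
    then show False using us(3) sum m by simp
  qed
  then have "2 * 2 \<le> n" unfolding n_def power2_eq_square by (intro mult_mono) auto
  then have n4: "4 \<le> n" by simp
  then have "3 \<le> length us" using us(3) by simp
  then obtain a b c xs where abc: "mset us = mset (a # b # c # xs)"
    and S: "real (length us) * (r a + r b + r c) \<le> 3 * (\<Sum>x\<leftarrow>us. r x)"
    using three_least_le_average[of us r] by metis
  have len: "real n = real (length us) + 1" using us(3) by linarith
  have "0 < real n * m" using m by linarith
  then have "0 < m" using n by (simp add: zero_less_mult_iff)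
  \<comment> \<open>With \<open>length us = n - 1\<close>, the comparison with
    \<open>(n - 1) * m\<close> reduces to \<open>3 < n * m + 2 * m\<close>, which follows from
    \<open>3 < n * m\<close> and \<open>0 < m\<close>.\<close>
  have "real (length us) * (r a + r b + r c) \<le> 3 - 3 * m" using S sum by linarith
  also have "\<dots> < real (length us) * m"
    using m \<open>0 < m\<close> unfolding len by (simp add: algebra_simps)
  finally have less: "r a + r b + r c < m" by (simp add: mult_less_cancel_left)
  have perm: "mset (v # us) = mset (v # a # b # c # xs)" using abc by simp
  have st: "set (v # us) = set (v # a # b # c # xs)" by (rule mset_eq_setD[OF perm])
  have "distinct (v # a # b # c # xs)" "length (v # a # b # c # xs) = d\<^sup>2"
    using us(2,3) mset_eq_imp_distinct_iff[OF perm] mset_eq_length[OF perm]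
    by (auto simp: n_def)
  then obtain U where "unitary_mat (d\<^sup>2) U" "entangled_wrt d U \<rho>"
    using entangled_wrt_of_orthonormal_basis[OF d herm us(1)[unfolded st n_def] _ _
      orth[unfolded st] ev r_def less] by blast
  then show ?thesis by (auto simp: factorization_by_def)
qed

end
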